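(* Let $\Theta\subseteq\mathbb{R}^n$ be a set of finite Lebesgue measure and let $U:\Theta\to[0,1]$ be measurable. Let $J\ge1$ and $\delta>0$, and consider the distribution $\pi(d\theta;J,\delta)\propto[U(\theta)+\delta]^J\lambda(d\theta)$ on $\Theta$. Then, for any $\alpha\in(0,1]$ and $\epsilon\in[0,1]$, $$\pi(\Theta(\epsilon,\alpha);J,\delta)\ \ge\ \frac{1}{1+\left[\frac{1+\delta}{\epsilon+1+\delta}\right]^{J}\left[\frac1\alpha\,\frac{1+\delta}{\epsilon+\delta}-1\right]\frac{1+\delta}{\delta}}.$$
   Context: $\lambda$ denotes Lebesgue measure; it is assumed $\lambda(\Theta)>0$. $\pi(\,\cdot\,;J,\delta)$ is the probability measure on $\Theta$ whose density with respect to $\lambda$ is $[U(\theta)+\delta]^J/\int_\Theta[U(\theta')+\delta]^J\lambda(d\theta')$. For $\epsilon\ge0$ and $\alpha\in[0,1]$, the set of approximate domain optimizers of $U$ with value imprecision $\epsilon$ and residual domain $\alpha$ is $$\Theta(\epsilon,\alpha):=\{\theta\in\Theta : \lambda(\{\theta'\in\Theta : U(\theta')>U(\theta)+\epsilon\})\le\alpha\,\lambda(\Theta)\}.$$ *)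

theory Defs
  imports "HOL-Analysis.Analysis"
begin

text \<open>
  Functions on \<open>\<Theta>\<close> are represented by total functions on the ambient space; only their values
  on \<open>\<Theta>\<close> enter the definitions below.  The set \<open>\<Theta>\<close> is meant to be Lebesgue measurable with
  finite measure, so that the real-valued \<open>measure\<close> is the usual Lebesgue measure.
\<close>

definition approx_domain_optimizers ::
  "(real ^ 'n) set \<Rightarrow> (real ^ 'n \<Rightarrow> real) \<Rightarrow> real \<Rightarrow> real \<Rightarrow> (real ^ 'n) set"
where
  "approx_domain_optimizers \<Theta> U \<epsilon> \<alpha> =
    {\<theta> \<in> \<Theta>. measure lebesgue {\<theta>' \<in> \<Theta>. U \<theta>' > U \<theta> + \<epsilon>} \<le> \<alpha> * measure lebesgue \<Theta>}"

text \<open>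
  The exponent \<open>J\<close> is real, hence \<open>powr\<close>; its base is positive on \<open>\<Theta>\<close> when \<open>U \<ge> 0\<close> and \<open>\<delta> > 0\<close>.
\<close>

definition opt_distribution ::
  "(real ^ 'n) set \<Rightarrow> (real ^ 'n \<Rightarrow> real) \<Rightarrow> real \<Rightarrow> real \<Rightarrow> (real ^ 'n) measure"
where
  "opt_distribution \<Theta> U J \<delta> =
    density (lebesgue_on \<Theta>)
      (\<lambda>\<theta>. ennreal ((U \<theta> + \<delta>) powr J / (\<integral>\<theta>'. (U \<theta>' + \<delta>) powr J \<partial>lebesgue_on \<Theta>)))"

end

theory Submission
  imports Defs
begin

text \<open>
  The optimizer set is a superlevel set of \<open>U\<close>.  Let \<open>t\<close> be the upper \<open>\<alpha>\<close>-quantile of \<open>U\<close>, so that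
  \<open>{U > t}\<close> has at most the fraction \<open>\<alpha>\<close> of the volume and \<open>{U \<ge> t}\<close> at least this fraction
  (\<open>upper_quantile_exists\<close>).  Then the approximate optimizers are exactly the points with
  \<open>U + \<epsilon> \<ge> t\<close>.  They include the set \<open>{U \<ge> t}\<close>, of relative volume at least \<open>\<alpha>\<close>, where the
  unnormalized density is at least \<open>(t + \<delta>)\<^sup>J\<close>.  The other points have relative volume at most
  \<open>1 - \<alpha>\<close>, and their density is at most \<open>(t - \<epsilon> + \<delta>)\<^sup>J \<le> (r (t + \<delta>))\<^sup>J\<close> with
  \<open>r = (1 + \<delta>) / (\<epsilon> + 1 + \<delta>)\<close>, because \<open>t \<le> 1\<close>.

  Hence the mass of the non-optimizers is at most \<open>r\<^sup>J (1 / \<alpha> - 1)\<close> times that of the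
  optimizers (\<open>power_weight_below_quantile\<close>), which gives the probability bound
  \<open>1 / (1 + r\<^sup>J (1 / \<alpha> - 1))\<close>.  The factors \<open>(1 + \<delta>) / (\<epsilon> + \<delta>)\<close> and \<open>(1 + \<delta>) / \<delta>\<close> of the
  theorem are at least one, so this bound is at least as strong as the stated one.
\<close>

section \<open>Upper quantiles\<close>

text \<open>
  The quantile is the infimum of the levels \<open>s \<ge> 0\<close> whose strict superlevel set has measure at
  most \<open>a\<close>.  Continuity of the measure from below shows that this infimum is attained, and
  continuity from above that the closed superlevel set keeps measure at least \<open>a\<close>.  Only levels
  \<open>s \<ge> 0\<close> are compared, so that a finite quantile exists even for \<open>a\<close> equal to the total mass.
\<close>

lemma (in finite_measure) upper_quantile_exists:
  fixes f :: "'a \<Rightarrow> real"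
  assumes f [measurable]: "f \<in> borel_measurable M"
    and nonneg: "\<And>x. x \<in> space M \<Longrightarrow> 0 \<le> f x"
    and a: "a \<le> measure M (space M)"
    and b: "0 \<le> b" "measure M {x \<in> space M. b < f x} \<le> a"
  obtains t where "0 \<le> t"
    and "\<And>s. 0 \<le> s \<Longrightarrow> measure M {x \<in> space M. s < f x} \<le> a \<longleftrightarrow> t \<le> s"
    and "a \<le> measure M {x \<in> space M. t \<le> f x}"
proof -
  define F where "F s = measure M {x \<in> space M. s < f x}" for s
  have anti: "F s' \<le> F s" if "s \<le> s'" for s s'
    unfolding F_def by (rule finite_measure_mono) (use that in auto)
  define S where "S = {s. 0 \<le> s \<and> F s \<le> a}"
  define t where "t = Inf S"
  have S_ne: "S \<noteq> {}" using b by (auto simp: S_def F_def)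
  have S_bdd: "bdd_below S" by (auto simp: S_def bdd_below_def)
  have t0: "0 \<le> t"
    unfolding t_def by (rule cInf_greatest[OF S_ne]) (auto simp: S_def)
  have above: "F s \<le> a" if "t < s" for s
  proof -
    obtain s' where "s' \<in> S" "s' < s"
      using \<open>t < s\<close> cInf_less_iff[OF S_ne S_bdd] by (auto simp: t_def)
    then show ?thesis using anti[of s' s] by (auto simp: S_def)
  qed
  have below: "a \<le> F s" if "s < t" for s
  proof (cases "0 \<le> s")
    case True
    then show ?thesis using cInf_lower[OF _ S_bdd, of s] that by (force simp: S_def t_def)
  next
    case False
    then have "{x \<in> space M. s < f x} = space M" using nonneg by force
    then show ?thesis using a by (simp add: F_def)
  qed
  have Ft: "F t \<le> a"
  proof -
    have "(\<lambda>n. F (t + 1 / real (Suc n))) \<longlonglongrightarrow>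
        measure M (\<Union>n. {x \<in> space M. t + 1 / real (Suc n) < f x})"
      unfolding F_def
    proof (rule finite_Lim_measure_incseq)
      show "incseq (\<lambda>n. {x \<in> space M. t + 1 / real (Suc n) < f x})"
        unfolding incseq_def
      proof (intro allI impI subsetI)
        fix m n :: nat and x
        assume "m \<le> n" and x: "x \<in> {x \<in> space M. t + 1 / real (Suc m) < f x}"
        then have "1 / real (Suc n) \<le> 1 / real (Suc m)" by (simp add: frac_le)
        with x show "x \<in> {x \<in> space M. t + 1 / real (Suc n) < f x}" by auto
      qed
    qed auto
    also have "(\<Union>n. {x \<in> space M. t + 1 / real (Suc n) < f x}) = {x \<in> space M. t < f x}"
    proof (intro equalityI subsetI)
      fix x assume x: "x \<in> {x \<in> space M. t < f x}"
      then obtain n where "inverse (real (Suc n)) < f x - t"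
        using reals_Archimedean[of "f x - t"] by auto
      with x show "x \<in> (\<Union>n. {x \<in> space M. t + 1 / real (Suc n) < f x})"
        by (auto simp: inverse_eq_divide intro!: exI[of _ n])
    next
      fix x assume "x \<in> (\<Union>n. {x \<in> space M. t + 1 / real (Suc n) < f x})"
      then obtain n where "x \<in> space M" "t + 1 / real (Suc n) < f x" by auto
      moreover have "0 < 1 / real (Suc n)" by simp
      ultimately show "x \<in> {x \<in> space M. t < f x}"
        by (metis (mono_tags, lifting) less_add_same_cancel1 mem_Collect_eq order_less_trans)
    qed
    finally have "(\<lambda>n. F (t + 1 / real (Suc n))) \<longlonglongrightarrow> F t" by (simp add: F_def)
    then show ?thesis by (rule LIMSEQ_le_const2) (auto intro!: above)
  qed
  have "a \<le> measure M {x \<in> space M. t \<le> f x}"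
  proof -
    have "(\<lambda>n. F (t - 1 / real (Suc n))) \<longlonglongrightarrow>
        measure M (\<Inter>n. {x \<in> space M. t - 1 / real (Suc n) < f x})"
      unfolding F_def
    proof (rule finite_Lim_measure_decseq)
      show "decseq (\<lambda>n. {x \<in> space M. t - 1 / real (Suc n) < f x})"
        unfolding decseq_def
      proof (intro allI impI subsetI)
        fix m n :: nat and x
        assume "m \<le> n" and x: "x \<in> {x \<in> space M. t - 1 / real (Suc n) < f x}"
        then have "1 / real (Suc n) \<le> 1 / real (Suc m)" by (simp add: frac_le)
        with x show "x \<in> {x \<in> space M. t - 1 / real (Suc m) < f x}" by auto
      qed
    qed auto
    also have "(\<Inter>n. {x \<in> space M. t - 1 / real (Suc n) < f x}) = {x \<in> space M. t \<le> f x}"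
    proof (intro equalityI subsetI)
      fix x assume x: "x \<in> (\<Inter>n. {x \<in> space M. t - 1 / real (Suc n) < f x})"
      have "t \<le> f x"
      proof (rule ccontr)
        assume "\<not> t \<le> f x"
        then obtain n where "inverse (real (Suc n)) < t - f x"
          using reals_Archimedean[of "t - f x"] by auto
        moreover have "t - 1 / real (Suc n) < f x" using x by blast
        ultimately show False by (simp add: inverse_eq_divide)
      qed
      with x show "x \<in> {x \<in> space M. t \<le> f x}" by auto
    next
      fix x assume x: "x \<in> {x \<in> space M. t \<le> f x}"
      have "t - 1 / real (Suc n) < f x" for n
      proof -
        have "0 < 1 / real (Suc n)" by simp
        moreover have "t \<le> f x" using x by simp
        ultimately show ?thesis by linarith
      qed
      with x show "x \<in> (\<Inter>n. {x \<in> space M. t - 1 / real (Suc n) < f x})" by blast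
    qed
    finally show ?thesis by (rule LIMSEQ_le_const) (auto intro!: below)
  qed
  moreover have "F s \<le> a \<longleftrightarrow> t \<le> s" if "0 \<le> s" for s
    using that anti[of t s] Ft cInf_lower[OF _ S_bdd, of s] by (auto simp: S_def t_def)
  ultimately show ?thesis using t0 that by (auto simp: F_def)
qed

section \<open>Power weights above and below a quantile\<close>

text \<open>
  The comparison is made at the level \<open>t\<close>: every point of \<open>{U < t - \<epsilon>}\<close> has weight at most
  \<open>r\<^sup>J (t + \<delta>)\<^sup>J\<close>, and every point of \<open>{U \<ge> t}\<close> has weight at least \<open>(t + \<delta>)\<^sup>J\<close>.  Since these
  sets are disjoint, the former has at most the relative volume \<open>1 - \<alpha>\<close> left over by the latter.
\<close>

lemma (in finite_measure) power_weight_below_quantile: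
  fixes U :: "'a \<Rightarrow> real" and J \<delta> \<alpha> \<epsilon> t :: real
  assumes U [measurable]: "U \<in> borel_measurable M"
    and range: "\<And>x. x \<in> space M \<Longrightarrow> U x \<in> {0..1}"
    and J: "0 \<le> J" and \<delta>: "0 < \<delta>" and \<alpha>: "0 < \<alpha>" "\<alpha> \<le> 1" and \<epsilon>: "0 \<le> \<epsilon>"
    and t: "0 \<le> t" "t \<le> 1"
    and quantile: "\<alpha> * measure M (space M) \<le> measure M {x \<in> space M. t \<le> U x}"
  shows "(\<integral>x. (U x + \<delta>) powr J * indicator {x \<in> space M. U x + \<epsilon> < t} x \<partial>M)
    \<le> ((1 + \<delta>) / (\<epsilon> + 1 + \<delta>)) powr J * (1 / \<alpha> - 1)
      * (\<integral>x. (U x + \<delta>) powr J * indicator {x \<in> space M. t \<le> U x + \<epsilon>} x \<partial>M)"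
    (is "?IB \<le> ?R * (1 / \<alpha> - 1) * ?IA")
proof -
  define m where "m = measure M (space M)"
  define B where "B = {x \<in> space M. U x + \<epsilon> < t}"
  define C where "C = {x \<in> space M. t \<le> U x}"
  have [measurable]: "B \<in> sets M" "C \<in> sets M" by (auto simp: B_def C_def)
  have weight_le: "(U x + \<delta>) powr J \<le> (1 + \<delta>) powr J" if "x \<in> space M" for x
    using range[OF that] \<delta> J by (auto intro!: powr_mono2)
  have int: "integrable M (\<lambda>x. (U x + \<delta>) powr J * indicator S x)" if "S \<in> sets M" for S
    by (rule integrable_const_bound[of _ "(1 + \<delta>) powr J"])
       (use that weight_le in \<open>auto simp: indicator_def\<close>)
  have "?IB \<le> (\<integral>x. ?R * (t + \<delta>) powr J * indicator B x \<partial>M)"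
  proof (rule integral_mono)
    fix x assume x: "x \<in> space M"
    have "(U x + \<delta>) powr J \<le> ?R * (t + \<delta>) powr J" if "U x + \<epsilon> < t"
    proof -
      (* Subtracting epsilon from t + delta leaves at most the fraction r of it, as t <= 1. *)
      have "\<epsilon> * (t + \<delta>) \<le> \<epsilon> * (\<epsilon> + 1 + \<delta>)"
        using t \<epsilon> by (intro mult_left_mono) auto
      then have "t + \<delta> - \<epsilon> \<le> (1 + \<delta>) / (\<epsilon> + 1 + \<delta>) * (t + \<delta>)"
        using \<delta> \<epsilon> by (simp add: field_simps)
      then have "U x + \<delta> \<le> (1 + \<delta>) / (\<epsilon> + 1 + \<delta>) * (t + \<delta>)"
        using that by linarith
      then have "(U x + \<delta>) powr J \<le> ((1 + \<delta>) / (\<epsilon> + 1 + \<delta>) * (t + \<delta>)) powr J"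
        using range[OF x] \<delta> J by (intro powr_mono2) auto
      also have "\<dots> = ?R * (t + \<delta>) powr J"
        by (rule powr_mult)
      finally show ?thesis .
    qed
    then show "(U x + \<delta>) powr J * indicator {x \<in> space M. U x + \<epsilon> < t} x
        \<le> ?R * (t + \<delta>) powr J * indicator B x"
      by (auto simp: B_def indicator_def)
  qed (auto intro!: int simp: emeasure_eq_measure)
  also have "\<dots> = ?R * (t + \<delta>) powr J * measure M B"
    by simp
  also have "\<dots> \<le> ?R * (t + \<delta>) powr J * (m - measure M C)"
  proof -
    have "measure M B + measure M C = measure M (B \<union> C)"
      by (rule finite_measure_Union[symmetric]) (use \<epsilon> in \<open>auto simp: B_def C_def\<close>)
    also have "\<dots> \<le> m" unfolding m_def by (rule bounded_measure)
    finally show ?thesis by (intro mult_left_mono) auto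
  qed
  also have "\<dots> \<le> ?R * (t + \<delta>) powr J * ((1 / \<alpha> - 1) * measure M C)"
    using quantile \<alpha>
    by (intro mult_left_mono) (auto simp: m_def C_def field_simps)
  finally have IB: "?IB \<le> ?R * (1 / \<alpha> - 1) * ((t + \<delta>) powr J * measure M C)"
    by (simp add: mult_ac)
  have IC: "(t + \<delta>) powr J * measure M C \<le> ?IA"
  proof -
    have "(t + \<delta>) powr J * measure M C = (\<integral>x. (t + \<delta>) powr J * indicator C x \<partial>M)"
      by simp
    also have "\<dots> \<le> ?IA"
    proof (rule integral_mono)
      fix x assume "x \<in> space M"
      then show "(t + \<delta>) powr J * indicator C x
          \<le> (U x + \<delta>) powr J * indicator {x \<in> space M. t \<le> U x + \<epsilon>} x"
        using t \<delta> \<epsilon> J by (auto simp: C_def indicator_def intro!: powr_mono2)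
    qed (auto intro!: int simp: emeasure_eq_measure)
    finally show ?thesis .
  qed
  have "0 \<le> ?R * (1 / \<alpha> - 1)" using \<alpha> by simp
  from mult_left_mono[OF IC this] IB show ?thesis by linarith
qed

section \<open>Mass of the approximate optimizers\<close>

lemma measure_normalized_density:
  fixes w :: "'a \<Rightarrow> real"
  assumes w: "integrable M w" "\<And>x. x \<in> space M \<Longrightarrow> 0 \<le> w x"
    and A: "A \<in> sets M"
  shows "measure (density M (\<lambda>x. ennreal (w x / (\<integral>y. w y \<partial>M)))) A
    = (\<integral>x. w x * indicator A x \<partial>M) / (\<integral>x. w x \<partial>M)"
proof -
  let ?Z = "\<integral>y. w y \<partial>M"
  note [measurable] = A borel_measurable_integrable[OF w(1)]
  have Z: "0 \<le> ?Z" using w(2) by (rule Bochner_Integration.integral_nonneg)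
  have "emeasure (density M (\<lambda>x. ennreal (w x / ?Z))) A
      = (\<integral>\<^sup>+x. ennreal (w x / ?Z) * indicator A x \<partial>M)"
    by (rule emeasure_density) auto
  also have "\<dots> = (\<integral>\<^sup>+x. ennreal (w x * indicator A x / ?Z) \<partial>M)"
    by (intro nn_integral_cong) (auto simp: indicator_def)
  also have "\<dots> = ennreal (\<integral>x. w x * indicator A x / ?Z \<partial>M)"
    by (rule nn_integral_eq_integral)
       (use w Z in \<open>auto intro!: integrable_real_mult_indicator\<close>)
  finally show ?thesis
    using w(2) Z by (simp add: measure_def Bochner_Integration.integral_nonneg)
qed

theorem theorem2:
  fixes \<Theta> :: "(real ^ 'n) set" and U :: "real ^ 'n \<Rightarrow> real"
    and J \<delta> \<alpha> \<epsilon> :: real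
  assumes "\<Theta> \<in> lmeasurable"
    and "measure lebesgue \<Theta> > 0"
    and "U \<in> borel_measurable (lebesgue_on \<Theta>)"
    and "\<And>\<theta>. \<theta> \<in> \<Theta> \<Longrightarrow> U \<theta> \<in> {0..1}"
    and "J \<ge> 1" and "\<delta> > 0"
    and "\<alpha> \<in> {0<..1}" and "\<epsilon> \<in> {0..1}"
  shows "measure (opt_distribution \<Theta> U J \<delta>) (approx_domain_optimizers \<Theta> U \<epsilon> \<alpha>) \<ge>
    1 / (1 + ((1 + \<delta>) / (\<epsilon> + 1 + \<delta>)) powr J *
      (1 / \<alpha> * ((1 + \<delta>) / (\<epsilon> + \<delta>)) - 1) * ((1 + \<delta>) / \<delta>))"
proof -
  let ?M = "lebesgue_on \<Theta>"
  let ?w = "\<lambda>\<theta>. (U \<theta> + \<delta>) powr J"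
  let ?R = "((1 + \<delta>) / (\<epsilon> + 1 + \<delta>)) powr J"
  interpret finite_measure ?M by (rule finite_measure_lebesgue_on[OF assms(1)])
  note [measurable] = assms(3)
  have \<Theta>: "\<Theta> \<in> sets lebesgue" using assms(1) by (rule fmeasurableD)
  have measure_M: "measure ?M S = measure lebesgue S" if "S \<subseteq> \<Theta>" for S
    using \<Theta> that by (intro measure_restrict_space) auto
  have m: "measure ?M (space ?M) = measure lebesgue \<Theta>" by (simp add: measure_M)
  have top: "{\<theta> \<in> space ?M. 1 < U \<theta>} = {}" using assms(4) by force
  obtain t where t0: "0 \<le> t"
    and t_iff: "\<And>s. 0 \<le> s \<Longrightarrow>
      measure ?M {\<theta> \<in> space ?M. s < U \<theta>} \<le> \<alpha> * measure lebesgue \<Theta> \<longleftrightarrow> t \<le> s"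
    and t_mass: "\<alpha> * measure lebesgue \<Theta> \<le> measure ?M {\<theta> \<in> space ?M. t \<le> U \<theta>}"
  proof (rule upper_quantile_exists[of U "\<alpha> * measure lebesgue \<Theta>" 1])
    show "\<alpha> * measure lebesgue \<Theta> \<le> measure ?M (space ?M)"
      using assms(7) by (simp only: m) (simp add: mult_left_le_one_le)
    show "measure ?M {\<theta> \<in> space ?M. 1 < U \<theta>} \<le> \<alpha> * measure lebesgue \<Theta>"
      unfolding top using assms(7) by simp
  qed (use assms(4) in auto)
  have t1: "t \<le> 1"
    using t_iff[of 1] assms(7) unfolding top by simp
  define A where "A = {\<theta> \<in> space ?M. t \<le> U \<theta> + \<epsilon>}"
  define B where "B = {\<theta> \<in> space ?M. U \<theta> + \<epsilon> < t}"
  have [measurable]: "A \<in> sets ?M" "B \<in> sets ?M"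
    unfolding A_def B_def by measurable
  have optimizers: "approx_domain_optimizers \<Theta> U \<epsilon> \<alpha> = A"
  proof -
    have "measure lebesgue {\<theta>' \<in> \<Theta>. U \<theta> + \<epsilon> < U \<theta>'} \<le> \<alpha> * measure lebesgue \<Theta>
        \<longleftrightarrow> t \<le> U \<theta> + \<epsilon>" if "\<theta> \<in> \<Theta>" for \<theta>
      using t_iff[of "U \<theta> + \<epsilon>"] assms(4)[OF that] assms(8)
      by (simp add: measure_M)
    then show ?thesis by (auto simp: approx_domain_optimizers_def A_def)
  qed
  have int: "integrable ?M ?w"
  proof (rule integrable_const_bound[of _ "(1 + \<delta>) powr J"])
    show "AE \<theta> in ?M. norm (?w \<theta>) \<le> (1 + \<delta>) powr J"
      using assms(4-6) by (intro AE_I2) (auto intro!: powr_mono2)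
  qed measurable
  define IA where "IA = (\<integral>\<theta>. ?w \<theta> * indicator A \<theta> \<partial>?M)"
  define IB where "IB = (\<integral>\<theta>. ?w \<theta> * indicator B \<theta> \<partial>?M)"
  have Z: "(\<integral>\<theta>. ?w \<theta> \<partial>?M) = IA + IB"
  proof -
    have "(\<integral>\<theta>. ?w \<theta> \<partial>?M) = (\<integral>\<theta>. ?w \<theta> * indicator A \<theta> + ?w \<theta> * indicator B \<theta> \<partial>?M)"
      by (rule Bochner_Integration.integral_cong) (auto simp: A_def B_def indicator_def)
    also have "\<dots> = IA + IB"
      unfolding IA_def IB_def
      by (intro Bochner_Integration.integral_add integrable_real_mult_indicator int) auto
    finally show ?thesis .
  qed
  have Z_pos: "0 < IA + IB"
  proof -
    have "\<delta> powr J * measure lebesgue \<Theta> = (\<integral>\<theta>. \<delta> powr J \<partial>?M)"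
      by (simp add: measure_M)
    also have "\<dots> \<le> (\<integral>\<theta>. ?w \<theta> \<partial>?M)"
      using assms(4-6) by (intro integral_mono int) (auto intro!: powr_mono2)
    finally show ?thesis
      using assms(2,6) Z by (metis less_le_trans mult_pos_pos powr_gt_zero less_irrefl)
  qed
  have IA0: "0 \<le> IA" unfolding IA_def by (rule Bochner_Integration.integral_nonneg) auto
  define K where "K = ?R * (1 / \<alpha> * ((1 + \<delta>) / (\<epsilon> + \<delta>)) - 1) * ((1 + \<delta>) / \<delta>)"
  have factor: "0 \<le> 1 / \<alpha> - 1"
    "1 / \<alpha> - 1 \<le> (1 / \<alpha> * ((1 + \<delta>) / (\<epsilon> + \<delta>)) - 1) * ((1 + \<delta>) / \<delta>)"
  proof -
    show *: "0 \<le> 1 / \<alpha> - 1" using assms(7) by simp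
    have "1 / \<alpha> * 1 \<le> 1 / \<alpha> * ((1 + \<delta>) / (\<epsilon> + \<delta>))"
      using assms(6-8) by (intro mult_left_mono) auto
    then have "(1 / \<alpha> - 1) * 1 \<le> (1 / \<alpha> * ((1 + \<delta>) / (\<epsilon> + \<delta>)) - 1) * ((1 + \<delta>) / \<delta>)"
      using * assms(6) by (intro mult_mono) auto
    then show "1 / \<alpha> - 1 \<le> (1 / \<alpha> * ((1 + \<delta>) / (\<epsilon> + \<delta>)) - 1) * ((1 + \<delta>) / \<delta>)" by simp
  qed
  have K: "?R * (1 / \<alpha> - 1) \<le> K" "0 \<le> K"
  proof -
    show "?R * (1 / \<alpha> - 1) \<le> K"
      unfolding K_def mult.assoc[of ?R] by (rule mult_left_mono[OF factor(2)]) simp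
    then show "0 \<le> K" using factor(1) by (smt (verit) mult_nonneg_nonneg powr_ge_zero)
  qed
  have "IB \<le> ?R * (1 / \<alpha> - 1) * IA"
    unfolding IA_def IB_def A_def B_def
    by (rule power_weight_below_quantile) (use assms t0 t1 t_mass m in auto)
  also have "\<dots> \<le> K * IA" by (rule mult_right_mono[OF K(1) IA0])
  finally have "IA + IB \<le> (1 + K) * IA" by (simp add: algebra_simps)
  then have "1 / (1 + K) \<le> IA / (IA + IB)"
    using Z_pos K(2) by (simp add: field_simps)
  also have "\<dots> = measure (opt_distribution \<Theta> U J \<delta>) (approx_domain_optimizers \<Theta> U \<epsilon> \<alpha>)"
    unfolding optimizers opt_distribution_def
    by (subst measure_normalized_density[OF int]) (auto simp: Z IA_def)
  finally show ?thesis by (simp only: K_def)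
qed

end
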